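(* For any integers $m\geq k\geq 2$ and any $\alpha\in(0,1)$ there exists a constant $\beta=\beta(\alpha,k,m)>0$ with the following property: if $H$ is a $k$-uniform hypergraph on $n$ vertices with $c_m(H)\geq \alpha\binom{n}{m}$, and $H$ does not contain a complete $m$-tuple of missing edges, then $\omega(H)\geq \beta n$.
   Context: A $k$-uniform hypergraph $H=(V,E)$ consists of a finite vertex set $V$ and an edge set $E\subset\binom{V}{k}$, where $\binom{S}{k}$ denotes the set of $k$-element subsets of $S$. A set $S\subset V$ is a clique if $\binom{S}{k}\subset E$; $\omega(H)$ is the maximum number of vertices of a clique in $H$, and $c_m(H)$ is the number of cliques in $H$ with exactly $m$ vertices. The set of missing edges is $M=\binom{V}{k}\setminus E$. For an integer $m\geq k$, a family $\{\tau_1,\dots,\tau_m\}\subset M$ is a complete $m$-tuple of missing edges if (1) $\tau_i\cap\tau_j=\emptyset$ for all $i\neq j$, and (2) $\{t_1,\dots,t_m\}$ is a clique in $H$ for every choice of $t_i\in\tau_i$, $i\in[m]$. For real $x$, $\binom{x}{k}=\frac{x(x-1)\cdots(x-k+1)}{k!}$ if $x\geq k-1$ and $0$ otherwise. *)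

theory Defs
  imports Complex_Main "HOL-Library.Ramsey"
begin

text \<open>The set of \<open>k\<close>-element subsets of \<open>V\<close> is \<^term>\<open>nsets V k\<close>.\<close>

definition uniform_hypergraph :: "nat \<Rightarrow> 'a set \<Rightarrow> 'a set set \<Rightarrow> bool" where
  "uniform_hypergraph k V E \<longleftrightarrow> finite V \<and> E \<subseteq> nsets V k"

text \<open>Every subset of \<open>V\<close> with fewer than \<open>k\<close> elements is a clique, as in the usual convention.\<close>

definition hyper_clique :: "nat \<Rightarrow> 'a set \<Rightarrow> 'a set set \<Rightarrow> 'a set \<Rightarrow> bool" where
  "hyper_clique k V E S \<longleftrightarrow> S \<subseteq> V \<and> nsets S k \<subseteq> E"

text \<open>For finite \<open>V\<close> the maximum ranges over a finite set containing \<open>card {} = 0\<close> (if \<open>k > 0\<close>).\<close>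

definition clique_number :: "nat \<Rightarrow> 'a set \<Rightarrow> 'a set set \<Rightarrow> nat" where
  "clique_number k V E = Max (card ` {S. hyper_clique k V E S})"

definition clique_count :: "nat \<Rightarrow> 'a set \<Rightarrow> 'a set set \<Rightarrow> nat \<Rightarrow> nat" where
  "clique_count k V E m = card {S. hyper_clique k V E S \<and> card S = m}"

definition missing_edges :: "nat \<Rightarrow> 'a set \<Rightarrow> 'a set set \<Rightarrow> 'a set set" where
  "missing_edges k V E = nsets V k - E"

definition complete_missing_tuple ::
    "nat \<Rightarrow> 'a set \<Rightarrow> 'a set set \<Rightarrow> nat \<Rightarrow> (nat \<Rightarrow> 'a set) \<Rightarrow> bool" where
  "complete_missing_tuple k V E m \<tau> \<longleftrightarrow>
     (\<forall>i\<in>{1..m}. \<tau> i \<in> missing_edges k V E) \<and>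
     (\<forall>i\<in>{1..m}. \<forall>j\<in>{1..m}. i \<noteq> j \<longrightarrow> \<tau> i \<inter> \<tau> j = {}) \<and>
     (\<forall>t. (\<forall>i\<in>{1..m}. t i \<in> \<tau> i) \<longrightarrow> hyper_clique k V E (t ` {1..m}))"

end

theory Submission
  imports Defs
begin

text \<open>
  Suppose that all cliques have fewer than \<open>\<beta> n\<close> vertices, and let \<open>F\<close> be a dense set of \<open>r\<close>-tuples
  of vertices. For an \<open>(r - 1)\<close>-tuple \<open>s\<close> put \<open>A s = {x. x # s \<in> F}\<close>. If some missing edge \<open>\<tau>\<close> lies in
  \<open>A s\<close> for a positive proportion of all \<open>s\<close>, recurse on the set of these \<open>s\<close>; after \<open>r\<close> such steps
  there are missing edges whose product lies in \<open>F\<close>. Starting with the \<open>m\<close>-cliques, listed without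
  repetition, this product is a complete \<open>m\<close>-tuple; disjointness comes from the tuples in \<open>F\<close> being
  repetition-free. Otherwise, averaging over \<open>s\<close> gives a linear-sized set \<open>A s\<close> that contains only a
  tiny proportion of missing edges. Since every set of \<open>\<beta> n\<close> vertices contains a missing edge, a
  maximal family \<open>T\<close> of disjoint missing edges inside \<open>A s\<close> has linear size, and a random choice of \<open>m\<close>
  members of \<open>T\<close> has no missing edge among its transversals.
\<close>

section \<open>Choosing an m-subset that avoids a small family of k-sets\<close>

lemma card_supersets_nsets:
  assumes "finite T" "B \<in> nsets T k" "k \<le> m"
  shows "card {S \<in> nsets T m. B \<subseteq> S} = (card T - k) choose (m - k)"
proof -
  have B: "B \<subseteq> T" "finite B" "card B = k"
    using assms(2) by (auto simp: nsets_def)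
  have "bij_betw (\<lambda>S. S - B) {S \<in> nsets T m. B \<subseteq> S} (nsets (T - B) (m - k))"
  proof (rule bij_betwI[where g = "\<lambda>S. S \<union> B"])
    show "(\<lambda>S. S - B) \<in> {S \<in> nsets T m. B \<subseteq> S} \<rightarrow> nsets (T - B) (m - k)"
      using B by (auto simp: nsets_def card_Diff_subset)
    show "(\<lambda>S. S \<union> B) \<in> nsets (T - B) (m - k) \<rightarrow> {S \<in> nsets T m. B \<subseteq> S}"
    proof
      fix S assume S: "S \<in> nsets (T - B) (m - k)"
      then have "S \<inter> B = {}" "finite S" "card S = m - k" by (auto simp: nsets_def)
      then have "card (S \<union> B) = m" using B assms(3) by (simp add: card_Un_disjoint)
      then show "S \<union> B \<in> {S \<in> nsets T m. B \<subseteq> S}"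
        using S B by (auto simp: nsets_def)
    qed
  qed (auto simp: nsets_def)
  then have "card {S \<in> nsets T m. B \<subseteq> S} = card (nsets (T - B) (m - k))"
    by (rule bij_betw_same_card)
  also have "\<dots> = (card T - k) choose (m - k)"
    using B assms(1) by (simp add: card_Diff_subset)
  finally show ?thesis .
qed

text \<open>A union bound: a uniformly random m-subset of \<open>T\<close> contains a fixed k-set
  with probability \<open>(m choose k) / (card T choose k)\<close>, so the expected number of
  members of the family inside it is below 1.\<close>

lemma nset_avoiding_small_family:
  assumes "finite T" "\<B> \<subseteq> nsets T k" "k \<le> m" "m \<le> card T"
    and few: "card \<B> * (m choose k) < card T choose k"
  shows "\<exists>S \<in> nsets T m. \<forall>B\<in>\<B>. \<not> B \<subseteq> S"
proof (rule ccontr)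
  assume "\<not> ?thesis"
  then have "nsets T m \<subseteq> (\<Union>B\<in>\<B>. {S \<in> nsets T m. B \<subseteq> S})" by blast
  moreover have fin: "finite \<B>"
    using assms(1,2) finite_imp_finite_nsets finite_subset by blast
  ultimately have "card (nsets T m) \<le> card (\<Union>B\<in>\<B>. {S \<in> nsets T m. B \<subseteq> S})"
    using assms(1) by (intro card_mono) (auto simp: finite_imp_finite_nsets)
  also have "\<dots> \<le> (\<Sum>B\<in>\<B>. card {S \<in> nsets T m. B \<subseteq> S})"
    using fin by (rule card_UN_le)
  also have "\<dots> = (\<Sum>B\<in>\<B>. (card T - k) choose (m - k))"
    using assms by (intro sum.cong refl card_supersets_nsets) auto
  finally have "card T choose m \<le> card \<B> * ((card T - k) choose (m - k))"
    by simp
  then have "(card T choose m) * (m choose k) \<le> card \<B> * (m choose k) * ((card T - k) choose (m - k))"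
    by (simp add: mult.commute mult.left_commute)
  also have "\<dots> < (card T choose k) * ((card T - k) choose (m - k))"
    using few assms(3,4) by (intro mult_strict_right_mono) auto
  also have "\<dots> = (card T choose m) * (m choose k)"
    using choose_mult[OF assms(3,4)] by simp
  finally show False by simp
qed

section \<open>Complete tuples from matchings of missing edges\<close>

text \<open>A missing edge inside a transversal of \<open>S\<close> takes its k vertices from k
  different members of the matching, and all of these lie in \<open>S\<close>. Hence only edges that
  meet exactly k members of \<open>T\<close> have to be avoided.\<close>

lemma complete_tuple_from_sparse_matching:
  assumes T: "T \<subseteq> missing_edges k V E" "pairwise disjnt T" "\<Union>T \<subseteq> A"
    and S: "S \<subseteq> T" "card S = m" "finite S"
    and avoid: "\<And>e. e \<in> missing_edges k V E \<inter> Pow A \<Longrightarrow> card {p\<in>T. p \<inter> e \<noteq> {}} = k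
                  \<Longrightarrow> \<not> {p\<in>T. p \<inter> e \<noteq> {}} \<subseteq> S"
  shows "\<exists>\<tau>. complete_missing_tuple k V E m \<tau>"
proof -
  obtain \<tau> where \<tau>: "bij_betw \<tau> {1..m} S"
    using S finite_same_card_bij[of "{1..m}" S] by auto
  then have \<tau>S: "\<tau> i \<in> S" if "i \<in> {1..m}" for i
    using that by (auto simp: bij_betw_def)
  have disj: "p \<inter> q = {}" if "p \<in> T" "q \<in> T" "p \<noteq> q" for p q
    using T(2) that by (auto simp: pairwise_def disjnt_def)
  have dis\<tau>: "\<tau> i \<inter> \<tau> j = {}" if "i \<in> {1..m}" "j \<in> {1..m}" "i \<noteq> j" for i j
  proof -
    have "\<tau> i \<noteq> \<tau> j"
      using inj_on_eq_iff[OF bij_betw_imp_inj_on[OF \<tau>]] that by simp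
    then show ?thesis using \<tau>S that S(1) by (intro disj) blast+
  qed
  have TV: "p \<subseteq> V" if "p \<in> T" for p
    using T(1) that by (auto simp: missing_edges_def nsets_def)
  have "hyper_clique k V E (t ` {1..m})" if t: "\<forall>i\<in>{1..m}. t i \<in> \<tau> i" for t
  proof -
    have sub: "t ` {1..m} \<subseteq> \<Union>T"
      using t \<tau>S S(1) by blast
    then have subV: "t ` {1..m} \<subseteq> V" using TV by blast
    have "nsets (t ` {1..m}) k \<subseteq> E"
    proof (rule ccontr)
      assume "\<not> ?thesis"
      then obtain e where e: "e \<subseteq> t ` {1..m}" "finite e" "card e = k" "e \<notin> E"
        by (auto simp: nsets_def)
      \<comment> \<open>These are the positions from which \<open>e\<close> takes its vertices.
        Disjointness of the \<open>\<tau> i\<close> makes both \<open>t\<close> and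
        \<open>\<tau>\<close> injective on \<open>I\<close>, so \<open>e\<close> and the set of
        members of \<open>T\<close> that it meets both have size \<open>card I\<close>.\<close>
      define I where "I = {i\<in>{1..m}. t i \<in> e}"
      have eI: "e = t ` I" using e(1) by (auto simp: I_def)
      have injt: "inj_on t I"
        using t dis\<tau> by (fastforce simp: inj_on_def I_def)
      have inj\<tau>: "inj_on \<tau> I"
        by (rule inj_on_subset[OF bij_betw_imp_inj_on[OF \<tau>]]) (auto simp: I_def)
      have parts: "{p\<in>T. p \<inter> e \<noteq> {}} = \<tau> ` I"
      proof (intro equalityI subsetI)
        fix p assume p: "p \<in> {p\<in>T. p \<inter> e \<noteq> {}}"
        then obtain i where i: "i \<in> I" "t i \<in> p" using eI by blast
        then have "t i \<in> \<tau> i" "\<tau> i \<in> T" using t \<tau>S S(1) by (auto simp: I_def)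
        then have "p = \<tau> i" using disj[of p "\<tau> i"] p i by blast
        then show "p \<in> \<tau> ` I" using i by blast
      next
        fix p assume "p \<in> \<tau> ` I"
        then show "p \<in> {p\<in>T. p \<inter> e \<noteq> {}}"
          using t \<tau>S S(1) by (auto simp: I_def)
      qed
      have "card {p\<in>T. p \<inter> e \<noteq> {}} = k"
        unfolding parts using card_image[OF inj\<tau>] card_image[OF injt] e(3) eI by simp
      moreover have "e \<in> missing_edges k V E \<inter> Pow A"
        using e subV subset_trans[OF e(1) subset_trans[OF sub T(3)]]
        by (auto simp: missing_edges_def nsets_def)
      ultimately have "\<not> {p\<in>T. p \<inter> e \<noteq> {}} \<subseteq> S" by (intro avoid)
      then show False unfolding parts using \<tau>S by (auto simp: I_def)
    qed
    then show ?thesis using subV by (simp add: hyper_clique_def)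
  qed
  moreover have "\<tau> i \<in> missing_edges k V E" if "i \<in> {1..m}" for i
    using \<tau>S that S(1) T(1) by blast
  ultimately show ?thesis
    using dis\<tau> unfolding complete_missing_tuple_def by blast
qed

text \<open>In a maximal matching the uncovered part of \<open>A\<close> contains no missing edge,
  so it is a clique and has fewer than \<open>b\<close> vertices; the matching covers the rest, k
  vertices per member.\<close>

lemma large_missing_matching:
  assumes H: "uniform_hypergraph k V E" and k: "0 < k" and A: "A \<subseteq> V"
    and noclique: "\<And>S. S \<subseteq> V \<Longrightarrow> b \<le> real (card S) \<Longrightarrow> \<not> hyper_clique k V E S"
  shows "\<exists>T. T \<subseteq> missing_edges k V E \<and> pairwise disjnt T \<and> \<Union>T \<subseteq> A \<and> finite T \<and>
           real (card A) \<le> b + real k * real (card T)"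
proof -
  have finV: "finite V" using H by (simp add: uniform_hypergraph_def)
  have finA: "finite A" using A finV finite_subset by blast
  define \<M> where "\<M> = {T. T \<subseteq> missing_edges k V E \<inter> Pow A \<and> pairwise disjnt T}"
  have finM: "finite (missing_edges k V E \<inter> Pow A)" using finA by simp
  have "finite \<M>"
    unfolding \<M>_def by (intro finite_subset[OF _ finite_Pow_iff[THEN iffD2, OF finM]]) auto
  moreover have "{} \<in> \<M>" by (simp add: \<M>_def)
  ultimately obtain T where T: "T \<in> \<M>" and max: "\<And>T'. T' \<in> \<M> \<Longrightarrow> T \<subseteq> T' \<Longrightarrow> T = T'"
    using finite_has_maximal[of \<M>] by (metis empty_iff)
  have finT: "finite T" using T finite_subset[OF _ finM, of T] by (auto simp: \<M>_def)
  have cT: "finite p \<and> card p = k" if "p \<in> T" for p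
    using T that by (auto simp: \<M>_def missing_edges_def nsets_def)
  have "hyper_clique k V E (A - \<Union>T)"
  proof (rule ccontr)
    assume "\<not> ?thesis"
    then obtain e where e: "e \<in> nsets (A - \<Union>T) k" "e \<notin> E"
      using A by (auto simp: hyper_clique_def)
    then have "insert e T \<in> \<M>"
      using T A by (auto simp: \<M>_def missing_edges_def nsets_def pairwise_insert disjnt_def)
    \<comment> \<open>A member of \<open>T\<close> lies inside \<open>\<Union>T\<close>, which
      \<open>e\<close> avoids; this would force \<open>e\<close> to be empty, contrary to
      \<open>0 < k\<close>.\<close>
    then have "e \<in> T" using max by blast
    moreover have "e \<noteq> {}" using e k by (auto simp: nsets_def)
    ultimately show False using e by (auto simp: nsets_def)
  qed
  then have "real (card (A - \<Union>T)) < b"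
    using noclique[of "A - \<Union>T"] A by force
  moreover have UA: "\<Union>T \<subseteq> A" using T by (auto simp: \<M>_def)
  moreover have "card (\<Union>T) = k * card T"
    using card_Union_disjoint[of T] T cT by (simp add: \<M>_def)
  moreover have "card A = card (A - \<Union>T) + card (\<Union>T)"
    using UA finA by (metis card_Diff_subset card_mono finite_subset le_add_diff_inverse2)
  ultimately have "real (card A) \<le> b + real k * real (card T)" by simp
  then show ?thesis using T UA finT by (auto simp: \<M>_def)
qed

text \<open>With \<open>n = card V\<close>, the bound \<open>b \<le> a / 2\<close> leaves at least
  \<open>a * n / 2\<close> vertices of \<open>A\<close> for the matching, which therefore has at
  least \<open>a * n / (2 * k)\<close> members. The second bound on \<open>b\<close>, together with
  \<open>1 \<le> b * n\<close>, makes this number at least m. The threshold in \<open>few\<close> is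
  the k-th power of this number divided by k, a lower bound for
  \<open>card T choose k\<close>.\<close>

lemma complete_tuple_in_nearly_complete_set:
  fixes a :: real
  assumes k: "0 < k" "k \<le> m" and a: "0 < a" "b \<le> a / 2" "b \<le> a / (2 * real k * real m)"
    and H: "uniform_hypergraph k V E" and A: "A \<subseteq> V" "a * real (card V) \<le> real (card A)"
    and big: "1 \<le> b * real (card V)"
    and noclique: "\<And>S. S \<subseteq> V \<Longrightarrow> b * real (card V) \<le> real (card S) \<Longrightarrow> \<not> hyper_clique k V E S"
    and few: "real (card (missing_edges k V E \<inter> Pow A)) * real (m choose k)
                < (a / (2 * real k ^ 2)) ^ k * real (card V) ^ k"
  shows "\<exists>\<tau>. complete_missing_tuple k V E m \<tau>"
proof -
  define n where "n = real (card V)"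
  have finA: "finite A"
    using A H finite_subset by (auto simp: uniform_hypergraph_def)
  obtain T where T: "T \<subseteq> missing_edges k V E" "pairwise disjnt T" "\<Union>T \<subseteq> A" "finite T"
    and cT: "real (card A) \<le> b * n + real k * real (card T)"
    using large_missing_matching[OF H k(1) A(1) noclique] unfolding n_def by blast
  have n: "0 < n" using big a by (auto simp: n_def intro: ccontr)
  have "b * n \<le> a / 2 * n" using a n by (intro mult_right_mono) auto
  then have "a * n / 2 \<le> real k * real (card T)"
    using cT A(2) by (simp add: n_def)
  then have cT': "a * n / (2 * real k) \<le> real (card T)"
    using k by (simp add: field_simps)
  have "1 \<le> b * n" using big by (simp add: n_def)
  also have "\<dots> \<le> a / (2 * real k * real m) * n"
    using a n by (intro mult_right_mono) auto
  finally have "real m \<le> a * n / (2 * real k)"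
    using k by (simp add: field_simps)
  with cT' have mT: "m \<le> card T" by linarith
  \<comment> \<open>\<open>\<phi> e\<close> is the set of matching members that \<open>e\<close>
    meets. Each missing edge forbids at most one k-subset of \<open>T\<close>, so
    \<open>\<B>\<close> is no larger than the set of missing edges inside \<open>A\<close>.\<close>
  define \<phi> where "\<phi> e = {p\<in>T. p \<inter> e \<noteq> {}}" for e
  define \<B> where "\<B> = \<phi> ` (missing_edges k V E \<inter> Pow A) \<inter> nsets T k"
  have "card \<B> \<le> card (\<phi> ` (missing_edges k V E \<inter> Pow A))"
    unfolding \<B>_def using finA by (intro card_mono) auto
  also have "\<dots> \<le> card (missing_edges k V E \<inter> Pow A)"
    using finA by (intro card_image_le) auto
  finally have "real (card \<B>) * real (m choose k)
      \<le> real (card (missing_edges k V E \<inter> Pow A)) * real (m choose k)"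
    by (intro mult_right_mono) auto
  also have "\<dots> < (a / (2 * real k ^ 2)) ^ k * n ^ k"
    using few by (simp add: n_def)
  also have "\<dots> = (a * n / (2 * real k) / real k) ^ k"
    by (simp add: power_mult_distrib power_divide power2_eq_square)
  also have "\<dots> \<le> (real (card T) / real k) ^ k"
    using cT' a n k by (intro power_mono divide_right_mono) auto
  also have "\<dots> \<le> real (card T choose k)"
    using mT k by (intro binomial_ge_n_over_k_pow_k) auto
  finally have "card \<B> * (m choose k) < card T choose k"
    by (metis of_nat_less_iff of_nat_mult)
  then obtain S where S: "S \<in> nsets T m" "\<forall>B\<in>\<B>. \<not> B \<subseteq> S"
    using nset_avoiding_small_family[OF T(4) _ k(2) mT, of \<B>] by (auto simp: \<B>_def)
  show ?thesis
  proof (rule complete_tuple_from_sparse_matching[OF T(1-3)])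
    show "S \<subseteq> T" "card S = m" "finite S" using S by (auto simp: nsets_def)
    fix e assume "e \<in> missing_edges k V E \<inter> Pow A" "card {p\<in>T. p \<inter> e \<noteq> {}} = k"
    then have "\<phi> e \<in> \<B>"
      using T(4) by (auto simp: \<B>_def \<phi>_def nsets_def)
    then show "\<not> {p\<in>T. p \<inter> e \<noteq> {}} \<subseteq> S" using S by (auto simp: \<phi>_def)
  qed
qed

section \<open>Averaging over sections\<close>

lemma card_nsets_le_power:
  assumes "finite V"
  shows "card (nsets V k) \<le> card V ^ k"
  using assms binomial_le_pow[of k "card V"]
  by (cases "k \<le> card V") (auto simp: binomial_eq_0)

lemma sum_card_double_count:
  assumes "finite X" "finite Y"
  shows "(\<Sum>x\<in>X. card {y\<in>Y. R x y}) = (\<Sum>y\<in>Y. card {x\<in>X. R x y})"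
  using assms by (intro sum_multicount_gen) auto

text \<open>Double counting the pairs of \<open>s\<close> and \<open>e\<close> with
  \<open>e \<subseteq> A s\<close> shows that a section contains at most
  \<open>c * card V ^ k\<close> members of \<open>M\<close> on average. Size and sparsity are needed
  for the same \<open>s\<close>, so the two averages are combined into one weight.\<close>

lemma large_section_with_few_members:
  fixes \<alpha> c :: real
  assumes "finite X" "finite V" "X \<noteq> {}" "V \<noteq> {}" "finite M" "0 < \<alpha>" "0 < c"
    and AV: "\<And>s. s \<in> X \<Longrightarrow> A s \<subseteq> V"
    and dense: "\<alpha> * real (card X) * real (card V) \<le> (\<Sum>s\<in>X. real (card (A s)))"
    and rare: "\<And>e. e \<in> M \<Longrightarrow> real (card {s\<in>X. e \<subseteq> A s}) \<le> c * real (card X)"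
    and M: "real (card M) \<le> real (card V) ^ k"
  shows "\<exists>s\<in>X. \<alpha> / 2 * real (card V) \<le> real (card (A s)) \<and>
           real (card (M \<inter> Pow (A s))) \<le> 2 * c / \<alpha> * real (card V) ^ k"
proof -
  define n where "n = real (card V)"
  have n: "0 < n" using assms by (simp add: n_def card_gt_0_iff)
  \<comment> \<open>Since the penalty term averages at most \<open>\<alpha> / 2\<close>, some \<open>s\<close> has \<open>w s \<ge> \<alpha> / 2\<close>, and this single
    inequality gives both bounds.\<close>
  define w where "w s = real (card (A s)) / n - \<alpha> / (2 * c) * (real (card (M \<inter> Pow (A s))) / n ^ k)" for s
  have "(\<Sum>s\<in>X. card (M \<inter> Pow (A s))) = (\<Sum>s\<in>X. card {e\<in>M. e \<subseteq> A s})"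
    by (intro sum.cong refl arg_cong[where f = card]) auto
  also have "\<dots> = (\<Sum>e\<in>M. card {s\<in>X. e \<subseteq> A s})"
    using assms by (intro sum_card_double_count) auto
  finally have "(\<Sum>s\<in>X. real (card (M \<inter> Pow (A s)))) = (\<Sum>e\<in>M. real (card {s\<in>X. e \<subseteq> A s}))"
    by (simp flip: of_nat_sum)
  also have "\<dots> \<le> (\<Sum>e\<in>M. c * real (card X))"
    by (intro sum_mono rare)
  also have "\<dots> \<le> n ^ k * (c * real (card X))"
    using M assms by (simp add: n_def mult_right_mono)
  finally have miss: "(\<Sum>s\<in>X. real (card (M \<inter> Pow (A s)))) / n ^ k \<le> c * real (card X)"
    using n by (simp add: field_simps)
  have "\<alpha> / 2 * real (card X) = \<alpha> * real (card X) - \<alpha> / (2 * c) * (c * real (card X))"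
    using assms by (simp add: field_simps)
  also have "\<dots> \<le> (\<Sum>s\<in>X. real (card (A s))) / n
      - \<alpha> / (2 * c) * ((\<Sum>s\<in>X. real (card (M \<inter> Pow (A s)))) / n ^ k)"
    using dense miss n assms
    by (intro diff_mono mult_left_mono) (auto simp: n_def field_simps)
  also have "\<dots> = (\<Sum>s\<in>X. w s)"
    by (simp add: w_def sum_subtractf sum_divide_distrib sum_distrib_left)
  finally have "(\<Sum>s\<in>X. \<alpha> / 2) \<le> (\<Sum>s\<in>X. w s)" by (simp add: mult.commute)
  then obtain s where s: "s \<in> X" "\<alpha> / 2 \<le> w s"
    using sum_strict_mono[OF assms(1,3), of w "\<lambda>_. \<alpha> / 2"] by force
  let ?q = "real (card (M \<inter> Pow (A s))) / n ^ k"
  have q: "0 \<le> \<alpha> / (2 * c) * ?q" using assms n by simp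
  \<comment> \<open>The first term of \<open>w s\<close> is at most 1 and \<open>w s\<close> is
    positive, so the penalty is at most 1; this bounds the number of members of \<open>M\<close>.
    The bound on the size of \<open>A s\<close> comes from dropping the penalty.\<close>
  have "card (A s) \<le> card V" using AV s assms by (intro card_mono) auto
  then have "real (card (A s)) / n \<le> 1" using n by (simp add: n_def)
  then have "\<alpha> / (2 * c) * ?q \<le> 1" using s(2) assms(6) unfolding w_def by linarith
  then have "2 * c / \<alpha> * (\<alpha> / (2 * c) * ?q) \<le> 2 * c / \<alpha> * 1"
    using assms(6,7) by (intro mult_left_mono) auto
  then have "?q \<le> 2 * c / \<alpha>" using assms(6,7) by simp
  then have "real (card (M \<inter> Pow (A s))) \<le> 2 * c / \<alpha> * n ^ k"
    using n by (simp add: divide_le_eq)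
  moreover have "\<alpha> / 2 \<le> real (card (A s)) / n" using s q by (simp add: w_def)
  then have "\<alpha> / 2 * n \<le> real (card (A s))" using n by (simp add: field_simps)
  ultimately show ?thesis using s by (auto simp: n_def)
qed

section \<open>Products of missing edges in dense sets of tuples\<close>

text \<open>Tuples are lists so that an induction on \<open>r\<close> can split off the first
  coordinate; \<open>list_all2 (\<in>)\<close> encodes membership in the product of the sets in
  \<open>ts\<close>. Disjointness of these sets is left to the application, where it follows from
  the choice of \<open>F\<close>.\<close>

definition forces_missing_product ::
    "nat \<Rightarrow> nat \<Rightarrow> nat \<Rightarrow> real \<Rightarrow> real \<Rightarrow> 'a set \<Rightarrow> 'a set set \<Rightarrow> 'a list set \<Rightarrow> bool" where
  "forces_missing_product k m r \<alpha> \<beta> V E F \<longleftrightarrow>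
     (uniform_hypergraph k V E \<longrightarrow> V \<noteq> {} \<longrightarrow>
      (\<forall>S\<subseteq>V. \<beta> * real (card V) \<le> real (card S) \<longrightarrow> \<not> hyper_clique k V E S) \<longrightarrow>
      (\<nexists>\<tau>. complete_missing_tuple k V E m \<tau>) \<longrightarrow>
      F \<subseteq> {xs. set xs \<subseteq> V \<and> length xs = r} \<longrightarrow>
      \<alpha> * real (card V) ^ r \<le> real (card F) \<longrightarrow>
      (\<exists>ts. length ts = r \<and> set ts \<subseteq> missing_edges k V E \<and>
         (\<forall>xs. list_all2 (\<in>) xs ts \<longrightarrow> xs \<in> F)))"

lemma forces_missing_productD:
  assumes "forces_missing_product k m r \<alpha> \<beta> V E F" "uniform_hypergraph k V E" "V \<noteq> {}"
    and "\<And>S. S \<subseteq> V \<Longrightarrow> \<beta> * real (card V) \<le> real (card S) \<Longrightarrow> \<not> hyper_clique k V E S"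
    and "\<nexists>\<tau>. complete_missing_tuple k V E m \<tau>"
    and "F \<subseteq> {xs. set xs \<subseteq> V \<and> length xs = r}"
    and "\<alpha> * real (card V) ^ r \<le> real (card F)"
  obtains ts where "length ts = r" "set ts \<subseteq> missing_edges k V E"
    "\<And>xs. list_all2 (\<in>) xs ts \<Longrightarrow> xs \<in> F"
  using assms unfolding forces_missing_product_def by blast

text \<open>Induction on \<open>r\<close> with the density \<alpha> generalised, because the set of
  tails passed to the induction hypothesis only has the smaller density \<open>c\<close>.\<close>

lemma missing_product_in_dense_family:
  fixes \<alpha> :: real
  assumes k: "2 \<le> k" "k \<le> m"
  shows "0 < \<alpha> \<Longrightarrow> \<exists>\<beta>>0. \<forall>(V :: 'a set) E F. forces_missing_product k m r \<alpha> \<beta> V E F"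
proof (induction r arbitrary: \<alpha>)
  case 0
  have "[] \<in> F" if "F \<subseteq> {xs. set xs \<subseteq> V \<and> length xs = 0}" "\<alpha> * real (card V) ^ 0 \<le> real (card F)"
    for V :: "'a set" and F
  proof -
    have "F \<noteq> {}" using that 0 by auto
    then show ?thesis using that(1) by auto
  qed
  \<comment> \<open>The list \<open>[]\<close> is the whole product for \<open>r = 0\<close>; the
    value 1 is just some positive number.\<close>
  then show ?case unfolding forces_missing_product_def by (intro exI[of _ 1]) auto
next
  case (Suc r)
  define a where "a = \<alpha> / 2"
  \<comment> \<open>\<epsilon> is half of what the sparsity condition on a section allows, the half
    making that inequality strict; \<open>c\<close> is then chosen so that the averaging bound
    \<open>2 * c / \<alpha>\<close> equals \<epsilon>.\<close>
  define \<epsilon> where "\<epsilon> = (a / (2 * real k ^ 2)) ^ k / (2 * real (m choose k))"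
  define c where "c = \<alpha> * \<epsilon> / 2"
  have a: "0 < a" using Suc.prems by (simp add: a_def)
  have mk: "0 < real (m choose k)" using k by simp
  have \<epsilon>: "0 < \<epsilon>" using a k mk by (simp add: \<epsilon>_def)
  have c: "0 < c" using \<epsilon> Suc.prems by (simp add: c_def)
  obtain \<gamma> where \<gamma>: "0 < \<gamma>"
    and IH: "\<And>(V :: 'a set) E F. forces_missing_product k m r c \<gamma> V E F"
    using Suc.IH[OF c] by blast
  \<comment> \<open>\<gamma> serves the induction hypothesis; the other two bounds serve the
    construction of a complete tuple inside a section.\<close>
  define \<beta> where "\<beta> = min \<gamma> (min (a / 2) (a / (2 * real k * real m)))"
  have \<beta>: "0 < \<beta>" "\<beta> \<le> \<gamma>" "\<beta> \<le> a / 2" "\<beta> \<le> a / (2 * real k * real m)"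
    using \<gamma> a k by (auto simp: \<beta>_def)
  show ?case
  proof (unfold forces_missing_product_def, intro exI[of _ \<beta>] conjI allI impI \<beta>(1))
    fix V :: "'a set" and E F
    assume H: "uniform_hypergraph k V E" and V: "V \<noteq> {}"
      and "\<forall>S\<subseteq>V. \<beta> * real (card V) \<le> real (card S) \<longrightarrow> \<not> hyper_clique k V E S"
      and no: "\<nexists>\<tau>. complete_missing_tuple k V E m \<tau>"
      and F: "F \<subseteq> {xs. set xs \<subseteq> V \<and> length xs = Suc r}"
      and dense: "\<alpha> * real (card V) ^ Suc r \<le> real (card F)"
    then have noclique: "\<And>S. S \<subseteq> V \<Longrightarrow> \<beta> * real (card V) \<le> real (card S) \<Longrightarrow> \<not> hyper_clique k V E S"
      by blast
    have finV: "finite V" using H by (simp add: uniform_hypergraph_def)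
    define X where "X = {xs. set xs \<subseteq> V \<and> length xs = r}"
    have finX: "finite X" and cX: "card X = card V ^ r"
      unfolding X_def using finV by (auto simp: finite_lists_length_eq card_lists_length_eq)
    define A where "A s = {x. x # s \<in> F}" for s
    have AV: "A s \<subseteq> V" for s using F by (auto simp: A_def)
    define M where "M = missing_edges k V E"
    have Msub: "M \<subseteq> nsets V k" by (auto simp: M_def missing_edges_def)
    have finM: "finite M" using Msub finV finite_imp_finite_nsets finite_subset by blast
    have "card M \<le> card V ^ k"
      using card_mono[OF finite_imp_finite_nsets[OF finV] Msub] card_nsets_le_power[OF finV, of k]
      by linarith
    then have cM: "real (card M) \<le> real (card V) ^ k"
      by (metis of_nat_le_iff of_nat_power)
    show "\<exists>ts. length ts = Suc r \<and> set ts \<subseteq> missing_edges k V E \<and>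
         (\<forall>xs. list_all2 (\<in>) xs ts \<longrightarrow> xs \<in> F)"
    proof (cases "\<exists>e\<in>M. c * real (card X) \<le> real (card {s\<in>X. e \<subseteq> A s})")
      case True
      \<comment> \<open>Every vertex of \<open>e\<close> extends each of these tails to a member of
        \<open>F\<close>, so a product found among the tails can be lengthened by
        \<open>e\<close>.\<close>
      then obtain e where e: "e \<in> M" "c * real (card X) \<le> real (card {s\<in>X. e \<subseteq> A s})" by blast
      have "\<not> hyper_clique k V E S" if "S \<subseteq> V" "\<gamma> * real (card V) \<le> real (card S)" for S
        using noclique[OF that(1)] that(2) mult_right_mono[OF \<beta>(2), of "real (card V)"] by simp
      moreover have "{s\<in>X. e \<subseteq> A s} \<subseteq> {xs. set xs \<subseteq> V \<and> length xs = r}"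
        by (auto simp: X_def)
      moreover have "c * real (card V) ^ r \<le> real (card {s\<in>X. e \<subseteq> A s})"
        using e(2) by (simp add: cX)
      ultimately obtain ts where "length ts = r" "set ts \<subseteq> missing_edges k V E"
        "\<And>xs. list_all2 (\<in>) xs ts \<Longrightarrow> xs \<in> {s\<in>X. e \<subseteq> A s}"
        using forces_missing_productD[OF IH H V _ no, of "{s\<in>X. e \<subseteq> A s}"] by blast
      then show ?thesis
        using e(1) by (intro exI[of _ "e # ts"]) (auto simp: M_def A_def list_all2_Cons2)
    next
      case False
      have "F = (\<Union>s\<in>X. (\<lambda>x. x # s) ` A s)"
        using F by (force simp: X_def A_def image_iff length_Suc_conv)
      then have "card F \<le> (\<Sum>s\<in>X. card ((\<lambda>x. x # s) ` A s))"
        using card_UN_le[OF finX] by metis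
      also have "\<dots> = (\<Sum>s\<in>X. card (A s))"
        by (intro sum.cong refl card_image) (auto simp: inj_on_def)
      finally have "real (card F) \<le> (\<Sum>s\<in>X. real (card (A s)))"
        by (simp flip: of_nat_sum)
      then have dense': "\<alpha> * real (card X) * real (card V) \<le> (\<Sum>s\<in>X. real (card (A s)))"
        using dense by (simp add: cX mult_ac)
      have X: "X \<noteq> {}" using cX finV V by (auto simp: card_gt_0_iff)
      have rare: "\<And>e. e \<in> M \<Longrightarrow> real (card {s\<in>X. e \<subseteq> A s}) \<le> c * real (card X)"
        using False by force
      obtain s where s: "s \<in> X" "a * real (card V) \<le> real (card (A s))"
          "real (card (M \<inter> Pow (A s))) \<le> 2 * c / \<alpha> * real (card V) ^ k"
        using large_section_with_few_members[OF finX finV X V finM Suc.prems c AV dense' rare cM]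
        unfolding a_def by blast
      have n: "0 < real (card V)" using finV V by (simp add: card_gt_0_iff)
      have "real (card (M \<inter> Pow (A s))) * real (m choose k)
          \<le> \<epsilon> * real (card V) ^ k * real (m choose k)"
        using s(3) Suc.prems by (intro mult_right_mono) (auto simp: c_def)
      also have "\<dots> = (a / (2 * real k ^ 2)) ^ k * real (card V) ^ k / 2"
        using mk by (simp add: \<epsilon>_def)
      also have "\<dots> < (a / (2 * real k ^ 2)) ^ k * real (card V) ^ k"
        using n a k by (simp add: field_simps)
      finally have few: "real (card (M \<inter> Pow (A s))) * real (m choose k)
                < (a / (2 * real k ^ 2)) ^ k * real (card V) ^ k" .
      \<comment> \<open>A single vertex is a clique because \<open>2 \<le> k\<close>, so cliques
        could not be absent at a threshold of at most 1.\<close>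
      have big: "1 \<le> \<beta> * real (card V)"
      proof (rule ccontr)
        assume "\<not> ?thesis"
        moreover obtain v where "v \<in> V" using V by blast
        ultimately have "\<not> hyper_clique k V E {v}" using noclique[of "{v}"] by simp
        moreover have "nsets {v} k = {}" using k by (intro nsets_eq_empty) auto
        ultimately show False using \<open>v \<in> V\<close> by (simp add: hyper_clique_def)
      qed
      have "\<exists>\<tau>. complete_missing_tuple k V E m \<tau>"
        by (rule complete_tuple_in_nearly_complete_set[OF _ k(2) a \<beta>(3,4) H AV s(2) big noclique])
          (use k few in \<open>auto simp: M_def\<close>)
      then show ?thesis using no by blast
    qed
  qed
qed

section \<open>From many cliques to a dense set of repetition-free lists\<close>

theorem theorem2:
  fixes k m :: nat and \<alpha> :: real
  assumes "2 \<le> k" and "k \<le> m" and "0 < \<alpha>" and "\<alpha> < 1"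
  shows "\<exists>\<beta>::real. \<beta> > 0 \<and>
    (\<forall>(n::nat) (V::'a set) (E::'a set set).
       uniform_hypergraph k V E \<longrightarrow> card V = n \<longrightarrow>
       real (clique_count k V E m) \<ge> \<alpha> * real (n choose m) \<longrightarrow>
       \<not> (\<exists>\<tau>. complete_missing_tuple k V E m \<tau>) \<longrightarrow>
       real (clique_number k V E) \<ge> \<beta> * real n)"
proof -
  have m: "0 < m" using assms by simp
  \<comment> \<open>The factor \<open>m ^ m\<close> comes from
    \<open>(n / m) ^ m \<le> n choose m\<close>, which turns the clique count into a density among
    all lists of length m.\<close>
  have "0 < \<alpha> / real m ^ m" using assms m by simp
  then obtain \<gamma> where \<gamma>: "0 < \<gamma>"
    and product: "\<And>(V :: 'a set) E F. forces_missing_product k m m (\<alpha> / real m ^ m) \<gamma> V E F"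
    using missing_product_in_dense_family[OF assms(1,2)] by blast
  \<comment> \<open>The bound \<open>1 / m\<close> guarantees \<open>m \<le> n\<close>: a single
    vertex is a clique, so the clique number is at least 1, yet it is below
    \<open>\<beta> * n \<le> n / m\<close>.\<close>
  define \<beta> where "\<beta> = min \<gamma> (1 / real m)"
  have \<beta>: "0 < \<beta>" "\<beta> \<le> \<gamma>" "\<beta> \<le> 1 / real m" using \<gamma> m by (auto simp: \<beta>_def)
  show ?thesis
  proof (intro exI[of _ \<beta>] conjI allI impI \<beta>(1), rule ccontr)
    fix n :: nat and V :: "'a set" and E :: "'a set set"
    assume H: "uniform_hypergraph k V E" and n: "card V = n"
      and count: "real (clique_count k V E m) \<ge> \<alpha> * real (n choose m)"
      and no: "\<nexists>\<tau>. complete_missing_tuple k V E m \<tau>"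
      and "\<not> \<beta> * real n \<le> real (clique_number k V E)"
    then have \<omega>: "real (clique_number k V E) < \<beta> * real n" by simp
    have finV: "finite V" using H by (simp add: uniform_hypergraph_def)
    have le_\<omega>: "card S \<le> clique_number k V E" if "hyper_clique k V E S" for S
    proof -
      have "finite {S. hyper_clique k V E S}"
        by (rule finite_subset[of _ "Pow V"]) (auto simp: hyper_clique_def finV)
      then show ?thesis
        unfolding clique_number_def using that by (intro Max_ge) auto
    qed
    have noclique: "\<not> hyper_clique k V E S" if "\<gamma> * real (card V) \<le> real (card S)" for S
      using le_\<omega>[of S] that \<omega> mult_right_mono[OF \<beta>(2), of "real n"] n by fastforce
    have V: "V \<noteq> {}" using \<omega> n by auto
    then obtain v where v: "v \<in> V" by blast
    have "nsets {v} k = {}" using assms by (intro nsets_eq_empty) auto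
    then have "card {v} \<le> clique_number k V E"
      using v by (intro le_\<omega>) (simp add: hyper_clique_def)
    then have "1 < \<beta> * real n" using \<omega> by simp
    also have "\<dots> \<le> 1 / real m * real n" using \<beta> by (intro mult_right_mono) auto
    finally have mn: "m \<le> n" using m by (simp add: field_simps)
    define F where "F = {xs. hyper_clique k V E (set xs) \<and> distinct xs \<and> length xs = m}"
    have FV: "F \<subseteq> {xs. set xs \<subseteq> V \<and> length xs = m}" by (auto simp: F_def hyper_clique_def)
    then have finF: "finite F" using finV finite_lists_length_eq finite_subset by blast
    have "{S. hyper_clique k V E S \<and> card S = m} \<subseteq> set ` F"
    proof
      fix S assume S: "S \<in> {S. hyper_clique k V E S \<and> card S = m}"
      then have "finite S" using finV finite_subset by (auto simp: hyper_clique_def)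
      then obtain xs where "set xs = S" "distinct xs" using finite_distinct_list by blast
      then show "S \<in> set ` F" using S by (force simp: F_def distinct_card)
    qed
    then have "clique_count k V E m \<le> card F"
      unfolding clique_count_def using finF surj_card_le by blast
    moreover have "(real n / real m) ^ m \<le> real (n choose m)"
      using mn by (rule binomial_ge_n_over_k_pow_k)
    then have "\<alpha> * (real n / real m) ^ m \<le> \<alpha> * real (n choose m)"
      using assms by simp
    ultimately have "\<alpha> / real m ^ m * real (card V) ^ m \<le> real (card F)"
      using count n by (simp add: power_divide)
    then obtain ts where ts: "length ts = m" "set ts \<subseteq> missing_edges k V E"
      "\<And>xs. list_all2 (\<in>) xs ts \<Longrightarrow> xs \<in> F"
      using forces_missing_productD[OF product H V noclique no FV] by blast
    \<comment> \<open>The shift by one reconciles the indices 1 to m of a complete tuple with list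
      positions, which start at 0.\<close>
    define \<tau> where "\<tau> i = ts ! (i - 1)" for i
    have \<tau>: "\<tau> i \<in> missing_edges k V E" if "i \<in> {1..m}" for i
      using that ts(1,2) by (auto simp: \<tau>_def intro!: subsetD[OF ts(2)] nth_mem)
    have trans: "map t [1..<Suc m] \<in> F" if t: "\<forall>i\<in>{1..m}. t i \<in> \<tau> i" for t
    proof (rule ts(3), unfold list_all2_conv_all_nth, intro conjI allI impI)
      fix i assume "i < length (map t [1..<Suc m])"
      then have i: "i < m" by (simp del: upt_Suc)
      then have "t (Suc i) \<in> \<tau> (Suc i)" using t by simp
      then show "map t [1..<Suc m] ! i \<in> ts ! i"
        using i by (simp add: \<tau>_def del: upt_Suc)
    qed (use ts(1) in simp)
    have "complete_missing_tuple k V E m \<tau>"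
      unfolding complete_missing_tuple_def
    proof (intro conjI ballI allI impI)
      fix i j assume ij: "i \<in> {1..m}" "j \<in> {1..m}" "i \<noteq> j"
      show "\<tau> i \<inter> \<tau> j = {}"
      proof (rule ccontr)
        assume "\<tau> i \<inter> \<tau> j \<noteq> {}"
        then obtain x where x: "x \<in> \<tau> i" "x \<in> \<tau> j" by blast
        have nonempty: "\<tau> l \<noteq> {}" if "l \<in> {1..m}" for l
          using \<tau>[OF that] assms(1) by (auto simp: missing_edges_def nsets_def)
        \<comment> \<open>A common vertex \<open>x\<close> of two of the sets would give a
          transversal that repeats \<open>x\<close>, although the lists in \<open>F\<close> are
          distinct. The remaining entries are arbitrary choices from nonempty sets.\<close>
        define t where "t l = (if l = i \<or> l = j then x else SOME y. y \<in> \<tau> l)" for l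
        have "\<forall>l\<in>{1..m}. t l \<in> \<tau> l"
          using x nonempty by (auto simp: t_def some_in_eq)
        then have "inj_on t {1..m}"
          using trans[of t]
          by (simp add: F_def distinct_map atLeastLessThanSuc_atLeastAtMost del: upt_Suc)
        then show False
          using inj_onD[of t "{1..m}" i j] ij by (simp add: t_def)
      qed
    next
      fix t assume "\<forall>i\<in>{1..m}. t i \<in> \<tau> i"
      from trans[OF this] show "hyper_clique k V E (t ` {1..m})"
        by (simp add: F_def atLeastLessThanSuc_atLeastAtMost del: upt_Suc)
    qed (rule \<tau>)
    then show False using no by blast
  qed
qed

end
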